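(* In the setting described in the context, let $\widehat{\pi}^{Q(\mathrm{prior})}_{\mathcal{D}}$ be an approximation of the push-forward density $\pi^{Q(\mathrm{prior})}_{\mathcal{D}}$, and suppose there exists a constant $C>0$ such that $$\pi^{\mathrm{obs}}_{\mathcal{D}}(q)\le C\,\widehat{\pi}^{Q(\mathrm{prior})}_{\mathcal{D}}(q)\quad\text{for }\mu_{\mathcal{D}}\text{-a.e. }q\in\mathcal{D}.$$ Then, with this same constant $C$, the error in the posterior satisfies $$d_{TV}\big(P^{\mathrm{post}}_{\Lambda},\widehat{P}^{\mathrm{post}}_{\Lambda}\big)\le C\,d_{TV}\big(P^{Q(\mathrm{prior})}_{\mathcal{D}},\widehat{P}^{Q(\mathrm{prior})}_{\mathcal{D}}\big).$$
   Context: Setting. $\Lambda\subset\mathbb{R}^n$ and $\mathcal{D}\subset\mathbb{R}^m$ are finite-dimensional metric spaces with Borel $\sigma$-algebras $\mathcal{B}_{\Lambda}$, $\mathcal{B}_{\mathcal{D}}$ and (volume) measures $\mu_{\Lambda}$, $\mu_{\mathcal{D}}$. $Q:\Lambda\to\mathcal{D}$ is a measurable map and $\mathcal{D}=Q(\Lambda)$. Assumption 1: either $\mu_{\mathcal{D}}$ is the push-forward volume measure $A\mapsto\mu_{\Lambda}(Q^{-1}(A))$, or the push-forward volume measure is absolutely continuous with respect to $\mu_{\mathcal{D}}$. The family $\{\mu_{\Lambda,q}\}_{q\in\mathcal{D}}$ is the disintegration of $\mu_{\Lambda}$ along $Q$ with respect to $\mu_{\mathcal{D}}$: each $\mu_{\Lambda,q}$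 is a measure on $(\Lambda,\mathcal{B}_{\Lambda})$ with $\mu_{\Lambda,q}(\Lambda\setminus Q^{-1}(q))=0$, for each $A\in\mathcal{B}_{\Lambda}$ the map $q\mapsto\mu_{\Lambda,q}(A)$ is measurable, and $\mu_{\Lambda}(A)=\int_{\mathcal{D}}\mu_{\Lambda,q}(A\cap Q^{-1}(q))\,d\mu_{\mathcal{D}}(q)$. The prior $P^{\mathrm{prior}}_{\Lambda}$ is a probability measure on $(\Lambda,\mathcal{B}_{\Lambda})$ with density $\pi^{\mathrm{prior}}_{\Lambda}$ with respect to $\mu_{\Lambda}$. Its push-forward $P^{Q(\mathrm{prior})}_{\mathcal{D}}(A)=P^{\mathrm{prior}}_{\Lambda}(Q^{-1}(A))$ has density $\pi^{Q(\mathrm{prior})}_{\mathcal{D}}$ with respect to $\mu_{\mathcal{D}}$, given by $\pi^{Q(\mathrm{prior})}_{\mathcal{D}}(q)=\int_{Q^{-1}(q)}\pi^{\mathrm{prior}}_{\Lambda}(\lambda)\,d\mu_{\Lambda,q}(\lambda)$. The observed measure $P^{\mathrm{obs}}_{\mathcal{D}}$ is a probability measure on $(\mathcal{D},\mathcal{B}_{\mathcal{D}})$ with density $\pi^{\mathrm{obs}}_{\mathcal{D}}$ with respect to $\mu_{\mathcal{D}}$. Assumption 2: there is a constant $C_0>0$ such that $\pi^{\mathrm{obs}}_{\mathcal{D}}(q)\le C_0\,\pi^{Q(\mathrm{prior})}_{\mathcal{D}}(q)$ for $\mu_{\mathcal{D}}$-a.e. $q\in\mathcal{D}$. Convention: a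 quotient is read as $0$ at points where its denominator vanishes. The posterior $P^{\mathrm{post}}_{\Lambda}$ is the measure on $(\Lambda,\mathcal{B}_{\Lambda})$ with density $$\pi^{\mathrm{post}}_{\Lambda}(\lambda)=\pi^{\mathrm{prior}}_{\Lambda}(\lambda)\,\frac{\pi^{\mathrm{obs}}_{\mathcal{D}}(Q(\lambda))}{\pi^{Q(\mathrm{prior})}_{\mathcal{D}}(Q(\lambda))}$$ with respect to $\mu_{\Lambda}$ (equivalently $P^{\mathrm{post}}_{\Lambda}(A)=\int_{\mathcal{D}}\int_{A\cap Q^{-1}(q)}\pi^{\mathrm{post}}_{\Lambda}\,d\mu_{\Lambda,q}\,d\mu_{\mathcal{D}}(q)$). The approximation $\widehat{\pi}^{Q(\mathrm{prior})}_{\mathcal{D}}:\mathcal{D}\to[0,\infty)$ is measurable and $\widehat{P}^{Q(\mathrm{prior})}_{\mathcal{D}}$ is the measure with this density with respect to $\mu_{\mathcal{D}}$. The corresponding approximate posterior $\widehat{P}^{\mathrm{post}}_{\Lambda}$ has density $$\widehat{\pi}^{\mathrm{post}}_{\Lambda}(\lambda)=\pi^{\mathrm{prior}}_{\Lambda}(\lambda)\,\frac{\pi^{\mathrm{obs}}_{\mathcal{D}}(Q(\lambda))}{\widehat{\pi}^{Q(\mathrm{prior})}_{\mathcal{D}}(Q(\lambda))}$$ with respect to $\mu_{\Lambda}$. Total variation distance (without factor $1/2$): for measures with densities $\pi_1,\pi_2$ with respect to a volume measure $\mu$ ($\mu=\mu_{\Lambda}$ on $\Lambda$, $\mu=\mu_{\mathcal{D}}$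 on $\mathcal{D}$), $d_{TV}=\int|\pi_1-\pi_2|\,d\mu$. *)

theory Defs
  imports "HOL-Probability.Probability"
begin

definition has_density :: "'a measure \<Rightarrow> 'a measure \<Rightarrow> ('a \<Rightarrow> real) \<Rightarrow> bool" where
  "has_density \<mu> P f \<longleftrightarrow>
     f \<in> borel_measurable \<mu> \<and> (\<forall>x\<in>space \<mu>. 0 \<le> f x) \<and> P = density \<mu> (\<lambda>x. ennreal (f x))"

text \<open>The total variation distance (without the factor 1/2) of two measures that have densities
  with respect to the volume measure. The value \<open>\<infinity>\<close> is possible if one of the measures is infinite.
  Independence of the chosen densities needs no \<open>\<sigma>\<close>-finiteness of the volume measure if the
  first measure is finite; see \<open>tv_dist_eq\<close> below.\<close>

definition tv_dist :: "'a measure \<Rightarrow> 'a measure \<Rightarrow> 'a measure \<Rightarrow> ennreal" where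
  "tv_dist \<mu> P\<^sub>1 P\<^sub>2 =
     (THE d. \<exists>\<pi>\<^sub>1 \<pi>\<^sub>2. has_density \<mu> P\<^sub>1 \<pi>\<^sub>1 \<and> has_density \<mu> P\<^sub>2 \<pi>\<^sub>2 \<and>
        d = (\<integral>\<^sup>+ x. ennreal \<bar>\<pi>\<^sub>1 x - \<pi>\<^sub>2 x\<bar> \<partial>\<mu>))"

lemma tv_integral_unique:
  assumes f: "has_density \<mu> P f" and f': "has_density \<mu> P f'"
    and g: "has_density \<mu> R g" and g': "has_density \<mu> R g'"
    and fin: "finite_measure P"
  shows "(\<integral>\<^sup>+ x. ennreal \<bar>f x - g x\<bar> \<partial>\<mu>) = (\<integral>\<^sup>+ x. ennreal \<bar>f' x - g' x\<bar> \<partial>\<mu>)"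
proof -
  have [measurable]: "f \<in> borel_measurable \<mu>" "f' \<in> borel_measurable \<mu>"
      "g \<in> borel_measurable \<mu>" "g' \<in> borel_measurable \<mu>"
    and nn: "\<And>x. x \<in> space \<mu> \<Longrightarrow> 0 \<le> f x" "\<And>x. x \<in> space \<mu> \<Longrightarrow> 0 \<le> f' x"
      "\<And>x. x \<in> space \<mu> \<Longrightarrow> 0 \<le> g x" "\<And>x. x \<in> space \<mu> \<Longrightarrow> 0 \<le> g' x"
    and P: "P = density \<mu> f" "P = density \<mu> f'" and R: "R = density \<mu> g" "R = density \<mu> g'"
    using f f' g g' by (auto simp: has_density_def)
  interpret P: finite_measure P by (rule fin)
  have "(\<integral>\<^sup>+ x. f x \<partial>\<mu>) = emeasure P (space \<mu>)"
    by (simp add: P(1) emeasure_density cong: nn_integral_cong)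
  also have "\<dots> \<noteq> \<infinity>" by simp
  finally have "(\<integral>\<^sup>+ x. f x \<partial>\<mu>) \<noteq> \<infinity>" .
  then have "AE x in \<mu>. ennreal (f x) = ennreal (f' x)"
    using P by (intro finite_density_unique[THEN iffD1]) auto
  then have ff': "AE x in \<mu>. f x = f' x"
    using AE_space by eventually_elim (use nn in auto)
  have "density P g = density R f"
    by (subst P(1), subst R(1)) (simp add: density_density_eq mult.commute)
  also have "\<dots> = density P g'"
    by (subst P(1), subst R(2)) (simp add: density_density_eq mult.commute)
  finally have "AE x in P. ennreal (g x) = ennreal (g' x)"
    by (subst (asm) P.density_unique_iff) (simp_all add: P(1))
  then have gg': "AE x in \<mu>. 0 < f x \<longrightarrow> g x = g' x"
    unfolding P(1) by (subst (asm) AE_density) (use nn AE_space in \<open>auto elim!: eventually_rev_mp\<close>)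
  define S where "S = {x \<in> space \<mu>. 0 < f x}"
  have [measurable]: "S \<in> sets \<mu>" unfolding S_def by measurable
  have split: "(\<integral>\<^sup>+ x. ennreal \<bar>f x - h x\<bar> \<partial>\<mu>) =
      (\<integral>\<^sup>+ x. ennreal \<bar>f x - h x\<bar> * indicator S x \<partial>\<mu>) + emeasure R (space \<mu> - S)"
    if [measurable]: "h \<in> borel_measurable \<mu>" and "R = density \<mu> h"
      and "\<And>x. x \<in> space \<mu> \<Longrightarrow> 0 \<le> h x" for h
  proof -
    have "emeasure R (space \<mu> - S) = (\<integral>\<^sup>+ x. ennreal (h x) * indicator (space \<mu> - S) x \<partial>\<mu>)"
      using that by (simp add: emeasure_density)
    moreover have "(\<integral>\<^sup>+ x. ennreal \<bar>f x - h x\<bar> \<partial>\<mu>) =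
        (\<integral>\<^sup>+ x. ennreal \<bar>f x - h x\<bar> * indicator S x + ennreal (h x) * indicator (space \<mu> - S) x \<partial>\<mu>)"
    proof (rule nn_integral_cong)
      fix x assume "x \<in> space \<mu>"
      then show "ennreal \<bar>f x - h x\<bar> =
          ennreal \<bar>f x - h x\<bar> * indicator S x + ennreal (h x) * indicator (space \<mu> - S) x"
        using nn(1)[of x] that(3)[of x] by (cases "0 < f x") (auto simp: S_def)
    qed
    ultimately show ?thesis
      by (simp add: nn_integral_add)
  qed
  have "(\<integral>\<^sup>+ x. ennreal \<bar>f x - g x\<bar> * indicator S x \<partial>\<mu>) =
      (\<integral>\<^sup>+ x. ennreal \<bar>f x - g' x\<bar> * indicator S x \<partial>\<mu>)"
    by (rule nn_integral_cong_AE) (use gg' in eventually_elim, auto simp: S_def indicator_def)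
  then have "(\<integral>\<^sup>+ x. ennreal \<bar>f x - g x\<bar> \<partial>\<mu>) = (\<integral>\<^sup>+ x. ennreal \<bar>f x - g' x\<bar> \<partial>\<mu>)"
    using split[of g] split[of g'] R nn by simp
  also have "\<dots> = (\<integral>\<^sup>+ x. ennreal \<bar>f' x - g' x\<bar> \<partial>\<mu>)"
    by (rule nn_integral_cong_AE) (use ff' in eventually_elim, simp)
  finally show ?thesis .
qed

lemma tv_dist_eq:
  assumes "has_density \<mu> P\<^sub>1 \<pi>\<^sub>1" "has_density \<mu> P\<^sub>2 \<pi>\<^sub>2" "finite_measure P\<^sub>1"
  shows "tv_dist \<mu> P\<^sub>1 P\<^sub>2 = (\<integral>\<^sup>+ x. ennreal \<bar>\<pi>\<^sub>1 x - \<pi>\<^sub>2 x\<bar> \<partial>\<mu>)"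
  unfolding tv_dist_def
  by (rule the_equality) (use assms in \<open>blast intro: tv_integral_unique\<close>)+

definition disintegration ::
    "'a measure \<Rightarrow> 'b measure \<Rightarrow> ('a \<Rightarrow> 'b) \<Rightarrow> ('b \<Rightarrow> 'a measure) \<Rightarrow> bool" where
  "disintegration \<mu>\<^sub>\<Lambda> \<mu>\<^sub>D Q \<kappa> \<longleftrightarrow>
     (\<forall>q\<in>space \<mu>\<^sub>D. sets (\<kappa> q) = sets \<mu>\<^sub>\<Lambda> \<and> emeasure (\<kappa> q) (space \<mu>\<^sub>\<Lambda> - Q -` {q}) = 0) \<and>
     (\<forall>A\<in>sets \<mu>\<^sub>\<Lambda>. (\<lambda>q. emeasure (\<kappa> q) A) \<in> borel_measurable \<mu>\<^sub>D) \<and>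
     (\<forall>A\<in>sets \<mu>\<^sub>\<Lambda>. emeasure \<mu>\<^sub>\<Lambda> A = (\<integral>\<^sup>+ q. emeasure (\<kappa> q) (A \<inter> Q -` {q}) \<partial>\<mu>\<^sub>D))"

text \<open>If \<open>\<pi>\<close> is the density of a finite measure and \<open>\<kappa>\<close> a disintegration, the integral fails to exist only
  for \<open>q\<close> in a \<open>\<mu>\<^sub>D\<close>-null set; there its value is 0 by the convention for the Bochner integral.\<close>

definition pushforward_density ::
    "('a \<Rightarrow> 'b) \<Rightarrow> ('b \<Rightarrow> 'a measure) \<Rightarrow> ('a \<Rightarrow> real) \<Rightarrow> 'b \<Rightarrow> real" where
  "pushforward_density Q \<kappa> \<pi> q = (LINT l:(Q -` {q})|\<kappa> q. \<pi> l)"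

text \<open>The convention that a quotient with denominator 0 is 0 is the one of real division.\<close>

definition posterior_density ::
    "('a \<Rightarrow> 'b) \<Rightarrow> ('a \<Rightarrow> real) \<Rightarrow> ('b \<Rightarrow> real) \<Rightarrow> ('b \<Rightarrow> real) \<Rightarrow> 'a \<Rightarrow> real" where
  "posterior_density Q \<pi>_prior \<pi>_obs \<rho> l = \<pi>_prior l * (\<pi>_obs (Q l) / \<rho> (Q l))"

definition posterior ::
    "'a measure \<Rightarrow> ('a \<Rightarrow> 'b) \<Rightarrow> ('a \<Rightarrow> real) \<Rightarrow> ('b \<Rightarrow> real) \<Rightarrow> ('b \<Rightarrow> real) \<Rightarrow> 'a measure" where
  "posterior \<mu>\<^sub>\<Lambda> Q \<pi>_prior \<pi>_obs \<rho> =
     density \<mu>\<^sub>\<Lambda> (\<lambda>l. ennreal (posterior_density Q \<pi>_prior \<pi>_obs \<rho> l))"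

end

theory Submission
  imports Defs
begin

text \<open>
  Integrating the prior density over the fibres of \<open>Q\<close> turns the disintegration into the statement
  that the push-forward of the prior has the density \<open>\<rho> = pushforward_density Q \<kappa> \<pi>_prior\<close>
  (\<open>has_density_pushforward\<close>). Both posteriors have densities of the form \<open>\<pi>_prior l * h (Q l)\<close>,
  with \<open>h\<close> the quotient of \<open>\<pi>_obs\<close> by \<open>\<rho>\<close> or by its approximation \<open>\<pi>_hat\<close>. The difference
  of the two quotients depends on \<open>l\<close> only through \<open>Q l\<close>, so the left-hand side becomes an integral
  over the data space:
  \<open>\<integral> \<pi>_prior * \<bar>\<pi>_obs/\<rho> - \<pi>_obs/\<pi>_hat\<bar> \<circ> Q d\<mu>\<^sub>\<Lambda> = \<integral> \<rho> * \<bar>\<pi>_obs/\<rho> - \<pi>_obs/\<pi>_hat\<bar> d\<mu>\<^sub>D\<close>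
  (\<open>nn_integral_prior_comp\<close>). Where \<open>\<rho>\<close> and \<open>\<pi>_hat\<close> are positive, the integrand on the right
  equals \<open>(\<pi>_obs/\<pi>_hat) * \<bar>\<pi>_hat - \<rho>\<bar>\<close>, and the first factor is at most \<open>C\<close>; elsewhere the integrand
  vanishes almost everywhere, since \<open>\<pi>_obs\<close> vanishes with \<open>\<pi>_hat\<close>.
\<close>

section \<open>Integration along the fibres\<close>

text \<open>Measurable singletons make the fibre a measurable set. Without this, the vanishing of
  \<open>emeasure (\<kappa> q)\<close> on its complement could be just the default value 0 on nonmeasurable sets.\<close>

lemma disintegration_AE_fibre:
  assumes dis: "disintegration \<mu>\<^sub>\<Lambda> \<mu>\<^sub>D Q \<kappa>" and Q: "Q \<in> measurable \<mu>\<^sub>\<Lambda> \<mu>\<^sub>D"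
    and q: "q \<in> space \<mu>\<^sub>D" "{q} \<in> sets \<mu>\<^sub>D"
  shows "AE l in \<kappa> q. Q l = q"
proof (rule AE_I)
  have s: "sets (\<kappa> q) = sets \<mu>\<^sub>\<Lambda>" and z: "emeasure (\<kappa> q) (space \<mu>\<^sub>\<Lambda> - Q -` {q}) = 0"
    using dis q(1) by (auto simp: disintegration_def)
  have "Q -` {q} \<inter> space \<mu>\<^sub>\<Lambda> \<in> sets \<mu>\<^sub>\<Lambda>"
    using measurable_sets[OF Q q(2)] .
  then have "space \<mu>\<^sub>\<Lambda> - (Q -` {q} \<inter> space \<mu>\<^sub>\<Lambda>) \<in> sets \<mu>\<^sub>\<Lambda>"
    by auto
  also have "space \<mu>\<^sub>\<Lambda> - (Q -` {q} \<inter> space \<mu>\<^sub>\<Lambda>) = space \<mu>\<^sub>\<Lambda> - Q -` {q}"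
    by auto
  finally show "space \<mu>\<^sub>\<Lambda> - Q -` {q} \<in> sets (\<kappa> q)"
    unfolding s .
  show "{l \<in> space (\<kappa> q). Q l \<noteq> q} \<subseteq> space \<mu>\<^sub>\<Lambda> - Q -` {q}"
    using sets_eq_imp_space_eq[OF s] by auto
  show "emeasure (\<kappa> q) (space \<mu>\<^sub>\<Lambda> - Q -` {q}) = 0"
    by (rule z)
qed

lemma emeasure_disintegration:
  assumes dis: "disintegration \<mu>\<^sub>\<Lambda> \<mu>\<^sub>D Q \<kappa>" and Q: "Q \<in> measurable \<mu>\<^sub>\<Lambda> \<mu>\<^sub>D"
    and sing: "\<And>q. q \<in> space \<mu>\<^sub>D \<Longrightarrow> {q} \<in> sets \<mu>\<^sub>D"
    and A: "A \<in> sets \<mu>\<^sub>\<Lambda>"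
  shows "emeasure \<mu>\<^sub>\<Lambda> A = (\<integral>\<^sup>+ q. emeasure (\<kappa> q) A \<partial>\<mu>\<^sub>D)"
proof -
  have "emeasure \<mu>\<^sub>\<Lambda> A = (\<integral>\<^sup>+ q. emeasure (\<kappa> q) (A \<inter> Q -` {q}) \<partial>\<mu>\<^sub>D)"
    using dis A by (auto simp: disintegration_def)
  also have "\<dots> = (\<integral>\<^sup>+ q. emeasure (\<kappa> q) A \<partial>\<mu>\<^sub>D)"
  proof (rule nn_integral_cong)
    fix q assume q: "q \<in> space \<mu>\<^sub>D"
    have s: "sets (\<kappa> q) = sets \<mu>\<^sub>\<Lambda>"
      using dis q by (auto simp: disintegration_def)
    have "A \<inter> Q -` {q} = A \<inter> (Q -` {q} \<inter> space \<mu>\<^sub>\<Lambda>)"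
      using sets.sets_into_space[OF A] by auto
    then have m: "A \<inter> Q -` {q} \<in> sets (\<kappa> q)"
      using A measurable_sets[OF Q sing[OF q]] s by auto
    show "emeasure (\<kappa> q) (A \<inter> Q -` {q}) = emeasure (\<kappa> q) A"
      using disintegration_AE_fibre[OF dis Q q sing[OF q]] m A s
      by (intro emeasure_eq_AE) (auto elim: eventually_mono)
  qed
  finally show ?thesis .
qed

text \<open>The disintegration formula passes from sets to nonnegative functions by the usual induction
  over indicators, linear combinations and monotone limits. Measurability of the inner integral has
  to be carried along, because the outer integral is additive and continuous only on measurable
  functions. The fibre measures may be infinite, which rules out the kernel results for
  subprobability measures.\<close>

lemma nn_integral_disintegration:
  fixes g :: "'a \<Rightarrow> ennreal"
  assumes dis: "disintegration \<mu>\<^sub>\<Lambda> \<mu>\<^sub>D Q \<kappa>" and Q: "Q \<in> measurable \<mu>\<^sub>\<Lambda> \<mu>\<^sub>D"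
    and sing: "\<And>q. q \<in> space \<mu>\<^sub>D \<Longrightarrow> {q} \<in> sets \<mu>\<^sub>D"
    and g: "g \<in> borel_measurable \<mu>\<^sub>\<Lambda>"
  shows "(\<lambda>q. \<integral>\<^sup>+ l. g l \<partial>\<kappa> q) \<in> borel_measurable \<mu>\<^sub>D" (is "?M g")
    and "(\<integral>\<^sup>+ l. g l \<partial>\<mu>\<^sub>\<Lambda>) = (\<integral>\<^sup>+ q. \<integral>\<^sup>+ l. g l \<partial>\<kappa> q \<partial>\<mu>\<^sub>D)" (is "?E g")
proof -
  have s: "sets (\<kappa> q) = sets \<mu>\<^sub>\<Lambda>" if "q \<in> space \<mu>\<^sub>D" for q
    using dis that by (auto simp: disintegration_def)
  have b: "f \<in> borel_measurable (\<kappa> q)"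
    if "q \<in> space \<mu>\<^sub>D" "f \<in> borel_measurable \<mu>\<^sub>\<Lambda>" for q and f :: "'a \<Rightarrow> ennreal"
    using that(2) measurable_cong_sets[OF s[OF that(1)] refl] by blast
  \<comment> \<open>In each induction case the inner integral has a closed form \<open>F\<close> only for \<open>q \<in> space \<mu>\<^sub>D\<close>, where
    \<open>\<kappa> q\<close> is controlled; this suffices for both claims.\<close>
  have via: "?M f \<and> ?E f"
    if F: "\<And>q. q \<in> space \<mu>\<^sub>D \<Longrightarrow> (\<integral>\<^sup>+ l. f l \<partial>\<kappa> q) = F q"
      "F \<in> borel_measurable \<mu>\<^sub>D" "(\<integral>\<^sup>+ l. f l \<partial>\<mu>\<^sub>\<Lambda>) = (\<integral>\<^sup>+ q. F q \<partial>\<mu>\<^sub>D)"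
    for f :: "'a \<Rightarrow> ennreal" and F
  proof
    show "?M f"
      using F(2) by (subst measurable_cong[OF F(1)])
    show "?E f"
      unfolding F(3) by (rule nn_integral_cong) (rule F(1)[symmetric])
  qed
  have "?M g \<and> ?E g"
    using g
  proof (induction rule: borel_measurable_induct)
    case (cong f g)
    show ?case
    proof (rule via)
      show "(\<integral>\<^sup>+ l. f l \<partial>\<kappa> q) = (\<integral>\<^sup>+ l. g l \<partial>\<kappa> q)" if "q \<in> space \<mu>\<^sub>D" for q
        using cong(3) sets_eq_imp_space_eq[OF s[OF that]] by (intro nn_integral_cong) auto
      have "(\<integral>\<^sup>+ l. f l \<partial>\<mu>\<^sub>\<Lambda>) = (\<integral>\<^sup>+ l. g l \<partial>\<mu>\<^sub>\<Lambda>)"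
        using cong(3) by (rule nn_integral_cong)
      then show "(\<integral>\<^sup>+ l. f l \<partial>\<mu>\<^sub>\<Lambda>) = (\<integral>\<^sup>+ q. \<integral>\<^sup>+ l. g l \<partial>\<kappa> q \<partial>\<mu>\<^sub>D)"
        using cong(4) by (blast intro: trans)
    qed (use cong(4) in blast)
  next
    case (set A)
    show ?case
    proof (rule via)
      show "(\<integral>\<^sup>+ l. indicator A l \<partial>\<kappa> q) = emeasure (\<kappa> q) A" if "q \<in> space \<mu>\<^sub>D" for q
        using set s[OF that] by simp
      show "(\<lambda>q. emeasure (\<kappa> q) A) \<in> borel_measurable \<mu>\<^sub>D"
        using dis set unfolding disintegration_def by blast
      show "(\<integral>\<^sup>+ l. indicator A l \<partial>\<mu>\<^sub>\<Lambda>) = (\<integral>\<^sup>+ q. emeasure (\<kappa> q) A \<partial>\<mu>\<^sub>D)"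
        unfolding nn_integral_indicator[OF set] by (rule emeasure_disintegration[OF dis Q sing set])
    qed
  next
    case (mult u c)
    have u: "?M u" "?E u"
      using mult by blast+
    show ?case
    proof (rule via)
      show "(\<integral>\<^sup>+ l. c * u l \<partial>\<kappa> q) = c * (\<integral>\<^sup>+ l. u l \<partial>\<kappa> q)" if "q \<in> space \<mu>\<^sub>D" for q
        using b[OF that mult(2)] by (rule nn_integral_cmult)
      show "(\<lambda>q. c * (\<integral>\<^sup>+ l. u l \<partial>\<kappa> q)) \<in> borel_measurable \<mu>\<^sub>D"
        using u(1) by (rule borel_measurable_times_ennreal[rotated]) simp
      show "(\<integral>\<^sup>+ l. c * u l \<partial>\<mu>\<^sub>\<Lambda>) = (\<integral>\<^sup>+ q. c * (\<integral>\<^sup>+ l. u l \<partial>\<kappa> q) \<partial>\<mu>\<^sub>D)"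
        unfolding nn_integral_cmult[OF mult(2)] nn_integral_cmult[OF u(1)] u(2) ..
    qed
  next
    case (add u v)
    have u: "?M u" "?E u" and v: "?M v" "?E v"
      using add by blast+
    show ?case
    proof (rule via)
      show "(\<integral>\<^sup>+ l. v l + u l \<partial>\<kappa> q) = (\<integral>\<^sup>+ l. v l \<partial>\<kappa> q) + (\<integral>\<^sup>+ l. u l \<partial>\<kappa> q)"
        if "q \<in> space \<mu>\<^sub>D" for q
        by (intro nn_integral_add b[OF that] add)
      show "(\<lambda>q. (\<integral>\<^sup>+ l. v l \<partial>\<kappa> q) + (\<integral>\<^sup>+ l. u l \<partial>\<kappa> q)) \<in> borel_measurable \<mu>\<^sub>D"
        using v(1) u(1) by (rule borel_measurable_add)
      have "(\<integral>\<^sup>+ l. v l + u l \<partial>\<mu>\<^sub>\<Lambda>) = (\<integral>\<^sup>+ l. v l \<partial>\<mu>\<^sub>\<Lambda>) + (\<integral>\<^sup>+ l. u l \<partial>\<mu>\<^sub>\<Lambda>)"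
        by (intro nn_integral_add add)
      then show "(\<integral>\<^sup>+ l. v l + u l \<partial>\<mu>\<^sub>\<Lambda>) =
          (\<integral>\<^sup>+ q. (\<integral>\<^sup>+ l. v l \<partial>\<kappa> q) + (\<integral>\<^sup>+ l. u l \<partial>\<kappa> q) \<partial>\<mu>\<^sub>D)"
        unfolding nn_integral_add[OF v(1) u(1)] u(2) v(2) .
    qed
  next
    case (seq U)
    have U: "?M (U n)" "?E (U n)" for n
      using seq by blast+
    show ?case
    proof (rule via)
      show "(\<integral>\<^sup>+ l. (SUP n. U n) l \<partial>\<kappa> q) = (SUP n. \<integral>\<^sup>+ l. U n l \<partial>\<kappa> q)"
        if "q \<in> space \<mu>\<^sub>D" for q
        unfolding SUP_apply
        by (intro nn_integral_monotone_convergence_SUP b[OF that] seq)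
      show "(\<lambda>q. SUP n. \<integral>\<^sup>+ l. U n l \<partial>\<kappa> q) \<in> borel_measurable \<mu>\<^sub>D"
        using U(1) by (intro borel_measurable_SUP) auto
      have inc: "incseq (\<lambda>n q. \<integral>\<^sup>+ l. U n l \<partial>\<kappa> q)"
        using \<open>incseq U\<close> by (auto simp: incseq_def le_fun_def intro!: nn_integral_mono)
      have "(\<integral>\<^sup>+ l. (SUP n. U n) l \<partial>\<mu>\<^sub>\<Lambda>) = (SUP n. \<integral>\<^sup>+ l. U n l \<partial>\<mu>\<^sub>\<Lambda>)"
        unfolding SUP_apply by (intro nn_integral_monotone_convergence_SUP seq)
      also have "\<dots> = (\<integral>\<^sup>+ q. (SUP n. \<integral>\<^sup>+ l. U n l \<partial>\<kappa> q) \<partial>\<mu>\<^sub>D)"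
        unfolding U(2) by (intro nn_integral_monotone_convergence_SUP[symmetric] inc U(1))
      finally show "(\<integral>\<^sup>+ l. (SUP n. U n) l \<partial>\<mu>\<^sub>\<Lambda>) =
          (\<integral>\<^sup>+ q. (SUP n. \<integral>\<^sup>+ l. U n l \<partial>\<kappa> q) \<partial>\<mu>\<^sub>D)" .
    qed
  qed
  then show "?M g" "?E g" by auto
qed

section \<open>The density of the push-forward\<close>

text \<open>Since \<open>\<kappa> q\<close> lives on the fibre, restricting the integral to \<open>Q -` {q}\<close> changes nothing. The
  equation also holds where the inner integral is infinite: both sides are then 0.\<close>

lemma pushforward_density_eq_nn_integral:
  assumes dis: "disintegration \<mu>\<^sub>\<Lambda> \<mu>\<^sub>D Q \<kappa>" and Q: "Q \<in> measurable \<mu>\<^sub>\<Lambda> \<mu>\<^sub>D"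
    and q: "q \<in> space \<mu>\<^sub>D" "{q} \<in> sets \<mu>\<^sub>D"
    and f: "f \<in> borel_measurable \<mu>\<^sub>\<Lambda>" "\<And>l. l \<in> space \<mu>\<^sub>\<Lambda> \<Longrightarrow> 0 \<le> f l"
  shows "pushforward_density Q \<kappa> f q = enn2real (\<integral>\<^sup>+ l. ennreal (f l) \<partial>\<kappa> q)"
proof -
  have s: "sets (\<kappa> q) = sets \<mu>\<^sub>\<Lambda>"
    using dis q by (auto simp: disintegration_def)
  have fm: "f \<in> borel_measurable (\<kappa> q)"
    using f(1) measurable_cong_sets[OF s refl] by blast
  have ind: "(\<lambda>l. indicator (Q -` {q}) l *\<^sub>R f l) \<in> borel_measurable (\<kappa> q)"
  proof -
    have "Q -` {q} \<inter> space (\<kappa> q) \<in> sets (\<kappa> q)"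
      using measurable_sets[OF Q q(2)] s sets_eq_imp_space_eq[OF s] by simp
    then have "(\<lambda>l. indicator (Q -` {q}) l :: real) \<in> borel_measurable (\<kappa> q)"
      by (simp add: borel_measurable_indicator_iff)
    then show ?thesis
      using fm by (intro borel_measurable_scaleR)
  qed
  have "pushforward_density Q \<kappa> f q = (\<integral> l. f l \<partial>\<kappa> q)"
    unfolding pushforward_density_def set_lebesgue_integral_def
    by (rule integral_cong_AE[OF ind fm], use disintegration_AE_fibre[OF dis Q q] in eventually_elim)
      (auto simp: indicator_def)
  also have "\<dots> = enn2real (\<integral>\<^sup>+ l. ennreal (f l) \<partial>\<kappa> q)"
    using fm f(2) sets_eq_imp_space_eq[OF s] by (intro integral_eq_nn_integral) auto
  finally show ?thesis .
qed

text \<open>Fibre integration applied to \<open>f\<close> times the indicator of \<open>Q -` A\<close>, which is constant on each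
  fibre, gives the mass that the push-forward assigns to \<open>A\<close>. Finiteness of \<open>P\<close> makes the fibre
  integral of \<open>f\<close> finite almost everywhere, so nothing is lost by passing to real values.\<close>

lemma has_density_pushforward:
  assumes dis: "disintegration \<mu>\<^sub>\<Lambda> \<mu>\<^sub>D Q \<kappa>" and Q: "Q \<in> measurable \<mu>\<^sub>\<Lambda> \<mu>\<^sub>D"
    and sing: "\<And>q. q \<in> space \<mu>\<^sub>D \<Longrightarrow> {q} \<in> sets \<mu>\<^sub>D"
    and P: "has_density \<mu>\<^sub>\<Lambda> P f" "finite_measure P"
  shows "has_density \<mu>\<^sub>D (distr P \<mu>\<^sub>D Q) (pushforward_density Q \<kappa> f)"
proof -
  have f[measurable]: "f \<in> borel_measurable \<mu>\<^sub>\<Lambda>" and f0: "\<And>l. l \<in> space \<mu>\<^sub>\<Lambda> \<Longrightarrow> 0 \<le> f l"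
    and Pd: "P = density \<mu>\<^sub>\<Lambda> (\<lambda>l. ennreal (f l))"
    using P(1) by (auto simp: has_density_def)
  note [measurable] = Q
  interpret finite_measure P by (rule P(2))
  define r where "r q = (\<integral>\<^sup>+ l. ennreal (f l) \<partial>\<kappa> q)" for q
  have \<rho>: "pushforward_density Q \<kappa> f q = enn2real (r q)" if "q \<in> space \<mu>\<^sub>D" for q
    unfolding r_def by (rule pushforward_density_eq_nn_integral[OF dis Q that sing[OF that] f f0])
  have r[measurable]: "r \<in> borel_measurable \<mu>\<^sub>D"
    unfolding r_def by (rule nn_integral_disintegration(1)[OF dis Q sing]) auto
  have "(\<integral>\<^sup>+ q. r q \<partial>\<mu>\<^sub>D) = (\<integral>\<^sup>+ l. ennreal (f l) \<partial>\<mu>\<^sub>\<Lambda>)"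
    unfolding r_def by (rule nn_integral_disintegration(2)[OF dis Q sing, symmetric]) auto
  also have "\<dots> = emeasure P (space \<mu>\<^sub>\<Lambda>)"
    by (simp add: Pd emeasure_density cong: nn_integral_cong)
  finally have "(\<integral>\<^sup>+ q. r q \<partial>\<mu>\<^sub>D) \<noteq> \<infinity>"
    by simp
  then have "AE q in \<mu>\<^sub>D. r q \<noteq> \<infinity>"
    by (intro nn_integral_noteq_infinite) auto
  then have AE_r: "AE q in \<mu>\<^sub>D. r q = ennreal (pushforward_density Q \<kappa> f q)"
    using AE_space by eventually_elim (simp add: \<rho> less_top)
  have \<rho>_meas[measurable]: "pushforward_density Q \<kappa> f \<in> borel_measurable \<mu>\<^sub>D"
    by (subst measurable_cong[OF \<rho>]) auto
  have "distr P \<mu>\<^sub>D Q = density \<mu>\<^sub>D r"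
  proof (rule measure_eqI)
    fix A assume "A \<in> sets (distr P \<mu>\<^sub>D Q)"
    then have A[measurable]: "A \<in> sets \<mu>\<^sub>D" by simp
    have m: "Q \<in> measurable P \<mu>\<^sub>D"
      using Q by (simp add: Pd)
    have "emeasure (distr P \<mu>\<^sub>D Q) A = (\<integral>\<^sup>+ q. indicator A q \<partial>distr P \<mu>\<^sub>D Q)"
      by simp
    also have "\<dots> = (\<integral>\<^sup>+ l. indicator A (Q l) \<partial>P)"
      by (rule nn_integral_distr[OF m]) simp
    also have "\<dots> = (\<integral>\<^sup>+ l. ennreal (f l) * indicator A (Q l) \<partial>\<mu>\<^sub>\<Lambda>)"
      unfolding Pd by (rule nn_integral_density) measurable
    also have "\<dots> = (\<integral>\<^sup>+ q. \<integral>\<^sup>+ l. ennreal (f l) * indicator A (Q l) \<partial>\<kappa> q \<partial>\<mu>\<^sub>D)"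
      by (rule nn_integral_disintegration(2)[OF dis Q sing]) auto
    also have "\<dots> = (\<integral>\<^sup>+ q. r q * indicator A q \<partial>\<mu>\<^sub>D)"
    proof (rule nn_integral_cong)
      fix q assume q: "q \<in> space \<mu>\<^sub>D"
      have s: "sets (\<kappa> q) = sets \<mu>\<^sub>\<Lambda>"
        using dis q by (auto simp: disintegration_def)
      have "(\<lambda>l. ennreal (f l)) \<in> borel_measurable \<mu>\<^sub>\<Lambda>"
        by measurable
      then have fm: "(\<lambda>l. ennreal (f l)) \<in> borel_measurable (\<kappa> q)"
        using measurable_cong_sets[OF s refl] by blast
      have "(\<integral>\<^sup>+ l. ennreal (f l) * indicator A (Q l) \<partial>\<kappa> q) =
          (\<integral>\<^sup>+ l. ennreal (f l) * indicator A q \<partial>\<kappa> q)"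
        by (rule nn_integral_cong_AE, use disintegration_AE_fibre[OF dis Q q sing[OF q]] in eventually_elim) simp
      also have "\<dots> = r q * indicator A q"
        unfolding r_def by (rule nn_integral_multc[OF fm])
      finally show "(\<integral>\<^sup>+ l. ennreal (f l) * indicator A (Q l) \<partial>\<kappa> q) = r q * indicator A q" .
    qed
    also have "\<dots> = emeasure (density \<mu>\<^sub>D r) A"
      by (simp add: emeasure_density)
    finally show "emeasure (distr P \<mu>\<^sub>D Q) A = emeasure (density \<mu>\<^sub>D r) A" .
  qed simp
  also have "\<dots> = density \<mu>\<^sub>D (\<lambda>q. ennreal (pushforward_density Q \<kappa> f q))"
    using AE_r by (intro density_cong) auto
  finally have "distr P \<mu>\<^sub>D Q = density \<mu>\<^sub>D (\<lambda>q. ennreal (pushforward_density Q \<kappa> f q))" .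
  then show ?thesis
    unfolding has_density_def using \<rho> \<rho>_meas by (metis enn2real_nonneg)
qed

text \<open>Change of variables: the prior enters an integral of a function of \<open>Q\<close> only through its
  push-forward.\<close>

lemma nn_integral_prior_comp:
  assumes P: "has_density \<mu>\<^sub>\<Lambda> P f" and R: "has_density \<mu>\<^sub>D (distr P \<mu>\<^sub>D Q) \<rho>"
    and Q: "Q \<in> measurable \<mu>\<^sub>\<Lambda> \<mu>\<^sub>D" and h: "h \<in> borel_measurable \<mu>\<^sub>D"
  shows "(\<integral>\<^sup>+ l. ennreal (f l * h (Q l)) \<partial>\<mu>\<^sub>\<Lambda>) = (\<integral>\<^sup>+ q. ennreal (\<rho> q * h q) \<partial>\<mu>\<^sub>D)"
proof -
  note [measurable] = Q h
  have [measurable]: "f \<in> borel_measurable \<mu>\<^sub>\<Lambda>" "\<rho> \<in> borel_measurable \<mu>\<^sub>D"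
    and f0: "\<And>l. l \<in> space \<mu>\<^sub>\<Lambda> \<Longrightarrow> 0 \<le> f l" and \<rho>0: "\<And>q. q \<in> space \<mu>\<^sub>D \<Longrightarrow> 0 \<le> \<rho> q"
    and Pd: "P = density \<mu>\<^sub>\<Lambda> (\<lambda>l. ennreal (f l))"
    and Rd: "distr P \<mu>\<^sub>D Q = density \<mu>\<^sub>D (\<lambda>q. ennreal (\<rho> q))"
    using P R by (auto simp: has_density_def)
  have "(\<integral>\<^sup>+ l. ennreal (f l * h (Q l)) \<partial>\<mu>\<^sub>\<Lambda>) = (\<integral>\<^sup>+ l. ennreal (f l) * ennreal (h (Q l)) \<partial>\<mu>\<^sub>\<Lambda>)"
    using f0 by (intro nn_integral_cong) (simp add: ennreal_mult')
  also have "\<dots> = (\<integral>\<^sup>+ l. ennreal (h (Q l)) \<partial>P)"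
    unfolding Pd by (subst nn_integral_density) auto
  also have "\<dots> = (\<integral>\<^sup>+ q. ennreal (h q) \<partial>distr P \<mu>\<^sub>D Q)"
    by (subst nn_integral_distr) (auto simp: Pd)
  also have "\<dots> = (\<integral>\<^sup>+ q. ennreal (\<rho> q) * ennreal (h q) \<partial>\<mu>\<^sub>D)"
    unfolding Rd by (subst nn_integral_density) auto
  also have "\<dots> = (\<integral>\<^sup>+ q. ennreal (\<rho> q * h q) \<partial>\<mu>\<^sub>D)"
    using \<rho>0 by (intro nn_integral_cong) (simp add: ennreal_mult')
  finally show ?thesis .
qed

section \<open>Posterior densities and the error bound\<close>

lemma has_density_posterior:
  assumes P: "has_density \<mu>\<^sub>\<Lambda> P f" and Q: "Q \<in> measurable \<mu>\<^sub>\<Lambda> \<mu>\<^sub>D"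
    and obs: "has_density \<mu>\<^sub>D P_obs g"
    and \<rho>: "\<rho> \<in> borel_measurable \<mu>\<^sub>D" "\<And>q. q \<in> space \<mu>\<^sub>D \<Longrightarrow> 0 \<le> \<rho> q"
  shows "has_density \<mu>\<^sub>\<Lambda> (posterior \<mu>\<^sub>\<Lambda> Q f g \<rho>) (posterior_density Q f g \<rho>)"
proof -
  note [measurable] = Q \<rho>(1)
  have [measurable]: "f \<in> borel_measurable \<mu>\<^sub>\<Lambda>" "g \<in> borel_measurable \<mu>\<^sub>D"
    and nn: "\<And>l. l \<in> space \<mu>\<^sub>\<Lambda> \<Longrightarrow> 0 \<le> f l" "\<And>q. q \<in> space \<mu>\<^sub>D \<Longrightarrow> 0 \<le> g q"
    using P obs by (auto simp: has_density_def)
  have "posterior_density Q f g \<rho> \<in> borel_measurable \<mu>\<^sub>\<Lambda>"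
    unfolding posterior_density_def[abs_def] by measurable
  moreover have "0 \<le> posterior_density Q f g \<rho> l" if "l \<in> space \<mu>\<^sub>\<Lambda>" for l
    using nn \<rho>(2) measurable_space[OF Q that] that by (simp add: posterior_density_def)
  ultimately show ?thesis
    by (auto simp: has_density_def posterior_def)
qed

text \<open>The exact posterior has at most the mass of the observed measure, because \<open>\<rho> * (g / \<rho>)\<close> is
  either \<open>g\<close> or 0. Finiteness makes the total variation distance from this posterior independent of
  the chosen densities.\<close>

lemma finite_measure_posterior:
  assumes P: "has_density \<mu>\<^sub>\<Lambda> P f" and R: "has_density \<mu>\<^sub>D (distr P \<mu>\<^sub>D Q) \<rho>"
    and Q: "Q \<in> measurable \<mu>\<^sub>\<Lambda> \<mu>\<^sub>D"
    and obs: "has_density \<mu>\<^sub>D P_obs g" "finite_measure P_obs"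
  shows "finite_measure (posterior \<mu>\<^sub>\<Lambda> Q f g \<rho>)"
proof
  interpret obs: finite_measure P_obs by (rule obs(2))
  have [measurable]: "\<rho> \<in> borel_measurable \<mu>\<^sub>D" "g \<in> borel_measurable \<mu>\<^sub>D"
    and \<rho>0: "\<And>q. q \<in> space \<mu>\<^sub>D \<Longrightarrow> 0 \<le> \<rho> q" and g0: "\<And>q. q \<in> space \<mu>\<^sub>D \<Longrightarrow> 0 \<le> g q"
    and od: "P_obs = density \<mu>\<^sub>D (\<lambda>q. ennreal (g q))"
    using R obs by (auto simp: has_density_def)
  have "has_density \<mu>\<^sub>\<Lambda> (posterior \<mu>\<^sub>\<Lambda> Q f g \<rho>) (posterior_density Q f g \<rho>)"
    using has_density_posterior[OF P Q obs(1)] \<rho>0 by simp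
  then have [measurable]: "posterior_density Q f g \<rho> \<in> borel_measurable \<mu>\<^sub>\<Lambda>"
    by (simp add: has_density_def)
  have "emeasure (posterior \<mu>\<^sub>\<Lambda> Q f g \<rho>) (space (posterior \<mu>\<^sub>\<Lambda> Q f g \<rho>)) =
      (\<integral>\<^sup>+ l. ennreal (posterior_density Q f g \<rho> l) \<partial>\<mu>\<^sub>\<Lambda>)"
    unfolding posterior_def by (simp add: emeasure_density cong: nn_integral_cong)
  also have "\<dots> = (\<integral>\<^sup>+ q. ennreal (\<rho> q * (g q / \<rho> q)) \<partial>\<mu>\<^sub>D)"
    unfolding posterior_density_def by (rule nn_integral_prior_comp[OF P R Q]) measurable
  also have "\<dots> \<le> (\<integral>\<^sup>+ q. ennreal (g q) \<partial>\<mu>\<^sub>D)"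
    using g0 by (intro nn_integral_mono ennreal_leI) auto
  also have "\<dots> = emeasure P_obs (space P_obs)"
    by (simp add: od emeasure_density cong: nn_integral_cong)
  also have "\<dots> < \<infinity>"
    by (simp add: less_top[symmetric])
  finally show "emeasure (posterior \<mu>\<^sub>\<Lambda> Q f g \<rho>) (space (posterior \<mu>\<^sub>\<Lambda> Q f g \<rho>)) \<noteq> \<infinity>"
    by simp
qed

text \<open>For positive \<open>r\<close> and \<open>s\<close> the left-hand side is \<open>(a / s) * \<bar>s - r\<bar>\<close>. If \<open>s = 0\<close>, the bound forces
  \<open>a = 0\<close>.\<close>

lemma weighted_quotient_diff_le:
  fixes a r s C :: real
  assumes "0 \<le> a" "0 \<le> r" "0 \<le> s" "0 \<le> C" "a \<le> C * s"
  shows "r * \<bar>a / r - a / s\<bar> \<le> C * \<bar>r - s\<bar>"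
proof (cases "r = 0 \<or> s = 0")
  case True
  then show ?thesis using assms by auto
next
  case False
  then have pos: "0 < r" "0 < s" using assms by auto
  have "a / r - a / s = (a / s) * ((s - r) / r)"
    using pos by (simp add: field_simps)
  then have "r * \<bar>a / r - a / s\<bar> = (a / s) * \<bar>r - s\<bar>"
    using pos assms(1) by (simp add: abs_mult abs_minus_commute)
  also have "\<dots> \<le> C * \<bar>r - s\<bar>"
    using pos assms(5) by (intro mult_right_mono) (auto simp: field_simps)
  finally show ?thesis .
qed

theorem theorem5p1:
  fixes \<Lambda> :: "(real ^ 'n) set" and D :: "(real ^ 'm) set"
    and \<mu>\<^sub>\<Lambda> :: "(real ^ 'n) measure" and \<mu>\<^sub>D :: "(real ^ 'm) measure"
    and Q :: "real ^ 'n \<Rightarrow> real ^ 'm"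
    and \<kappa> :: "real ^ 'm \<Rightarrow> (real ^ 'n) measure"
    and P_prior :: "(real ^ 'n) measure" and \<pi>_prior :: "real ^ 'n \<Rightarrow> real"
    and P_obs :: "(real ^ 'm) measure" and \<pi>_obs :: "real ^ 'm \<Rightarrow> real"
    and \<pi>_hat :: "real ^ 'm \<Rightarrow> real"
    and C\<^sub>0 C :: real
  assumes "sets \<mu>\<^sub>\<Lambda> = sets (restrict_space borel \<Lambda>)"
    and "sets \<mu>\<^sub>D = sets (restrict_space borel D)"
    and "Q \<in> measurable \<mu>\<^sub>\<Lambda> \<mu>\<^sub>D" and "D = Q ` \<Lambda>"
    and volume_compat: "\<mu>\<^sub>D = distr \<mu>\<^sub>\<Lambda> \<mu>\<^sub>D Q \<or> absolutely_continuous \<mu>\<^sub>D (distr \<mu>\<^sub>\<Lambda> \<mu>\<^sub>D Q)"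
    and "disintegration \<mu>\<^sub>\<Lambda> \<mu>\<^sub>D Q \<kappa>"
    and "prob_space P_prior" and "has_density \<mu>\<^sub>\<Lambda> P_prior \<pi>_prior"
    and "prob_space P_obs" and "has_density \<mu>\<^sub>D P_obs \<pi>_obs"
    and dominated: "C\<^sub>0 > 0" "AE q in \<mu>\<^sub>D. \<pi>_obs q \<le> C\<^sub>0 * pushforward_density Q \<kappa> \<pi>_prior q"
    and "\<pi>_hat \<in> borel_measurable \<mu>\<^sub>D" and "\<And>q. q \<in> D \<Longrightarrow> 0 \<le> \<pi>_hat q"
    and "C > 0" and "AE q in \<mu>\<^sub>D. \<pi>_obs q \<le> C * \<pi>_hat q"
  shows "tv_dist \<mu>\<^sub>\<Lambda>
           (posterior \<mu>\<^sub>\<Lambda> Q \<pi>_prior \<pi>_obs (pushforward_density Q \<kappa> \<pi>_prior))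
           (posterior \<mu>\<^sub>\<Lambda> Q \<pi>_prior \<pi>_obs \<pi>_hat)
         \<le> ennreal C * tv_dist \<mu>\<^sub>D (distr P_prior \<mu>\<^sub>D Q) (density \<mu>\<^sub>D (\<lambda>q. ennreal (\<pi>_hat q)))"
proof -
  let ?\<rho> = "pushforward_density Q \<kappa> \<pi>_prior"
  note Q[measurable] = assms(3)
  note prior = assms(8) and obs = assms(10)
  note hat[measurable] = assms(13)
  interpret prior: prob_space P_prior by fact
  interpret obs: prob_space P_obs by fact
  have space_D: "space \<mu>\<^sub>D = D"
    using sets_eq_imp_space_eq[OF assms(2)] by (simp add: space_restrict_space)
  have hat0: "\<And>q. q \<in> space \<mu>\<^sub>D \<Longrightarrow> 0 \<le> \<pi>_hat q"
    using assms(14) by (simp add: space_D)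
  have sing: "{q} \<in> sets \<mu>\<^sub>D" if "q \<in> space \<mu>\<^sub>D" for q
  proof -
    have "{q} = D \<inter> {q}" using that space_D by auto
    then show ?thesis
      unfolding assms(2) sets_restrict_space by (metis borel_singleton image_eqI sets.empty_sets)
  qed
  have R: "has_density \<mu>\<^sub>D (distr P_prior \<mu>\<^sub>D Q) ?\<rho>"
    by (rule has_density_pushforward[OF assms(6) Q sing prior prior.finite_measure_axioms])
  have \<rho>[measurable]: "?\<rho> \<in> borel_measurable \<mu>\<^sub>D" and \<rho>0: "\<And>q. q \<in> space \<mu>\<^sub>D \<Longrightarrow> 0 \<le> ?\<rho> q"
    using R by (auto simp: has_density_def)
  have [measurable]: "\<pi>_obs \<in> borel_measurable \<mu>\<^sub>D" and obs0: "\<And>q. q \<in> space \<mu>\<^sub>D \<Longrightarrow> 0 \<le> \<pi>_obs q"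
    using obs by (auto simp: has_density_def)
  have prior0: "\<And>l. l \<in> space \<mu>\<^sub>\<Lambda> \<Longrightarrow> 0 \<le> \<pi>_prior l"
    using prior by (auto simp: has_density_def)
  have m: "Q \<in> measurable P_prior \<mu>\<^sub>D"
    using Q prior by (simp add: has_density_def)
  have hat_density: "has_density \<mu>\<^sub>D (density \<mu>\<^sub>D (\<lambda>q. ennreal (\<pi>_hat q))) \<pi>_hat"
    using hat0 by (simp add: has_density_def)
  have "tv_dist \<mu>\<^sub>\<Lambda> (posterior \<mu>\<^sub>\<Lambda> Q \<pi>_prior \<pi>_obs ?\<rho>) (posterior \<mu>\<^sub>\<Lambda> Q \<pi>_prior \<pi>_obs \<pi>_hat) =
      (\<integral>\<^sup>+ l. ennreal \<bar>posterior_density Q \<pi>_prior \<pi>_obs ?\<rho> l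
          - posterior_density Q \<pi>_prior \<pi>_obs \<pi>_hat l\<bar> \<partial>\<mu>\<^sub>\<Lambda>)"
    by (intro tv_dist_eq has_density_posterior[OF prior Q obs]
        finite_measure_posterior[OF prior R Q obs obs.finite_measure_axioms] \<rho> hat \<rho>0 hat0)
  also have "\<dots> =
      (\<integral>\<^sup>+ l. ennreal (\<pi>_prior l * \<bar>\<pi>_obs (Q l) / ?\<rho> (Q l) - \<pi>_obs (Q l) / \<pi>_hat (Q l)\<bar>) \<partial>\<mu>\<^sub>\<Lambda>)"
    using prior0 unfolding posterior_density_def right_diff_distrib[symmetric]
    by (intro nn_integral_cong) (simp only: abs_mult abs_of_nonneg)
  also have "\<dots> = (\<integral>\<^sup>+ q. ennreal (?\<rho> q * \<bar>\<pi>_obs q / ?\<rho> q - \<pi>_obs q / \<pi>_hat q\<bar>) \<partial>\<mu>\<^sub>D)"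
    by (rule nn_integral_prior_comp[OF prior R Q]) measurable
  also have "\<dots> \<le> (\<integral>\<^sup>+ q. ennreal C * ennreal \<bar>?\<rho> q - \<pi>_hat q\<bar> \<partial>\<mu>\<^sub>D)"
  proof (rule nn_integral_mono_AE)
    show "AE q in \<mu>\<^sub>D. ennreal (?\<rho> q * \<bar>\<pi>_obs q / ?\<rho> q - \<pi>_obs q / \<pi>_hat q\<bar>)
        \<le> ennreal C * ennreal \<bar>?\<rho> q - \<pi>_hat q\<bar>"
      using assms(16) AE_space
    proof eventually_elim
      case (elim q)
      then have "?\<rho> q * \<bar>\<pi>_obs q / ?\<rho> q - \<pi>_obs q / \<pi>_hat q\<bar> \<le> C * \<bar>?\<rho> q - \<pi>_hat q\<bar>"
        using obs0 \<rho>0 hat0 \<open>C > 0\<close> by (intro weighted_quotient_diff_le) auto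
      then show ?case
        using \<open>C > 0\<close> by (simp add: ennreal_mult[symmetric] ennreal_leI)
    qed
  qed
  also have "\<dots> = ennreal C * (\<integral>\<^sup>+ q. ennreal \<bar>?\<rho> q - \<pi>_hat q\<bar> \<partial>\<mu>\<^sub>D)"
    by (rule nn_integral_cmult) measurable
  also have "(\<integral>\<^sup>+ q. ennreal \<bar>?\<rho> q - \<pi>_hat q\<bar> \<partial>\<mu>\<^sub>D) =
      tv_dist \<mu>\<^sub>D (distr P_prior \<mu>\<^sub>D Q) (density \<mu>\<^sub>D (\<lambda>q. ennreal (\<pi>_hat q)))"
    by (rule tv_dist_eq[OF R hat_density prior.finite_measure_distr[OF m], symmetric])
  finally show ?thesis .
qed

end
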